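(* Let $f\colon M\to M$ be an expansive homeomorphism with canonical coordinates of a compact metric space, let $\mathrm{d}$ be a self-similar metric for $f$, let $C\subset M$ be a product box and let $p\in C$. Then $(C,\mathrm{d})$ and $(C,\mathrm{d}_p)$ are pseudo isometric, where $\mathrm{d}_p(x,y)=\max\{\mathrm{d}(x^s,y^s),\mathrm{d}(x^u,y^u)\}$ for $x,y\in C$, with $x^s=W^s_\xi(p)\cap W^u_\xi(x)$ and $x^u=W^u_\xi(p)\cap W^s_\xi(x)$.
   Context: Self-similar metric: a metric $\mathrm{d}$ compatible with the topology of $M$ for which there are an expansive constant $\eta>0$ and an expanding factor $\lambda>1$ such that $\mathrm{d}(p,q)\le\eta$ implies $\max\{\mathrm{d}(f(p),f(q)),\mathrm{d}(f^{-1}(p),f^{-1}(q))\}=\lambda\,\mathrm{d}(p,q)$. Fix $\xi>0$ such that $3\xi$ is an expansive constant. Local stable/unstable sets: $W^s_\epsilon(x)=\{y:\mathrm{d}(f^n(x),f^n(y))\le\epsilon\ \forall n\ge0\}$ and $W^u_\epsilon(x)=\{y:\mathrm{d}(f^{-n}(x),f^{-n}(y))\le\epsilon\ \forall n\ge0\}$. Canonical coordinates: for each $\epsilon>0$ there is $\delta>0$ such that $\mathrm{d}(x,y)<\delta$ implies $W^s_\epsilon(x)\cap W^u_\epsilon(y)\ne\emptyset$. If $2\epsilon$ is an expansive constant this intersection is a single point, denoted $[x,y]$. Product box: for $q\in M$ and small $r>0$, $C_r(q)=\{[y,x]:x\in W^s_r(q),\,y\in W^u_r(q)\}$. Here $r$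 is taken small enough that all brackets between points of the box, and the intersections defining $x^s,x^u$, are defined and are single points (identified with the point). Pseudo isometry: a homeomorphism $h\colon(X_1,\mathrm{d}_1)\to(X_2,\mathrm{d}_2)$ of metric spaces such that for all $\epsilon>0$ there is $\delta>0$ such that $0<\mathrm{d}_1(x,y)<\delta$ implies $\left|\frac{\mathrm{d}_2(h(x),h(y))}{\mathrm{d}_1(x,y)}-1\right|<\epsilon$; $X_1$ and $X_2$ are then called pseudo isometric. *)

theory Defs
  imports "HOL-Analysis.Analysis"
begin

text \<open>
  A space is a carrier set \<open>M\<close> together with a distance function \<open>d\<close>, as in the locale
  \<^locale>\<open>Metric_space\<close>. The inverse of a homeomorphism \<open>f\<close> of \<open>M\<close> is \<open>inv_into M f\<close>, and
  \<open>(inv_into M f ^^ n) x\<close> stands for the point obtained by applying \<open>f\<close> to \<open>x\<close>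
  with exponent \<open>-n\<close>.
\<close>

definition expansive_constant ::
  "'a set \<Rightarrow> ('a \<Rightarrow> 'a \<Rightarrow> real) \<Rightarrow> ('a \<Rightarrow> 'a) \<Rightarrow> real \<Rightarrow> bool" where
  "expansive_constant M d f \<eta> \<longleftrightarrow> \<eta> > 0 \<and>
     (\<forall>x\<in>M. \<forall>y\<in>M.
        (\<forall>n::nat. d ((f ^^ n) x) ((f ^^ n) y) \<le> \<eta> \<and>
           d ((inv_into M f ^^ n) x) ((inv_into M f ^^ n) y) \<le> \<eta>) \<longrightarrow> x = y)"

definition expansive :: "'a set \<Rightarrow> ('a \<Rightarrow> 'a \<Rightarrow> real) \<Rightarrow> ('a \<Rightarrow> 'a) \<Rightarrow> bool" where
  "expansive M d f \<longleftrightarrow> (\<exists>\<eta>. expansive_constant M d f \<eta>)"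

definition stable_set ::
  "'a set \<Rightarrow> ('a \<Rightarrow> 'a \<Rightarrow> real) \<Rightarrow> ('a \<Rightarrow> 'a) \<Rightarrow> real \<Rightarrow> 'a \<Rightarrow> 'a set" where
  "stable_set M d f \<epsilon> x = {y \<in> M. \<forall>n::nat. d ((f ^^ n) x) ((f ^^ n) y) \<le> \<epsilon>}"

definition unstable_set ::
  "'a set \<Rightarrow> ('a \<Rightarrow> 'a \<Rightarrow> real) \<Rightarrow> ('a \<Rightarrow> 'a) \<Rightarrow> real \<Rightarrow> 'a \<Rightarrow> 'a set" where
  "unstable_set M d f \<epsilon> x =
     {y \<in> M. \<forall>n::nat. d ((inv_into M f ^^ n) x) ((inv_into M f ^^ n) y) \<le> \<epsilon>}"

definition canonical_coordinates ::
  "'a set \<Rightarrow> ('a \<Rightarrow> 'a \<Rightarrow> real) \<Rightarrow> ('a \<Rightarrow> 'a) \<Rightarrow> bool" where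
  "canonical_coordinates M d f \<longleftrightarrow>
     (\<forall>\<epsilon>>0. \<exists>\<delta>>0. \<forall>x\<in>M. \<forall>y\<in>M. d x y < \<delta> \<longrightarrow>
        stable_set M d f \<epsilon> x \<inter> unstable_set M d f \<epsilon> y \<noteq> {})"

definition self_similar_metric ::
  "'a set \<Rightarrow> 'a topology \<Rightarrow> ('a \<Rightarrow> 'a) \<Rightarrow> ('a \<Rightarrow> 'a \<Rightarrow> real) \<Rightarrow> bool" where
  "self_similar_metric M T f d \<longleftrightarrow>
     Metric_space M d \<and> Metric_space.mtopology M d = T \<and>
     (\<exists>\<eta> \<kappa>. expansive_constant M d f \<eta> \<and> \<kappa> > 1 \<and>
        (\<forall>p\<in>M. \<forall>q\<in>M. d p q \<le> \<eta> \<longrightarrow>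
           max (d (f p) (f q)) (d (inv_into M f p) (inv_into M f q)) = \<kappa> * d p q))"

text \<open>
  The bracket \<open>[x, y]\<close> at scale \<open>\<xi>\<close>. It is meaningful only where \<open>bracket_defined\<close> holds;
  otherwise \<^const>\<open>the_elem\<close> returns an unspecified point.
\<close>

definition bracket_defined ::
  "'a set \<Rightarrow> ('a \<Rightarrow> 'a \<Rightarrow> real) \<Rightarrow> ('a \<Rightarrow> 'a) \<Rightarrow> real \<Rightarrow> 'a \<Rightarrow> 'a \<Rightarrow> bool" where
  "bracket_defined M d f \<xi> x y \<longleftrightarrow>
     is_singleton (stable_set M d f \<xi> x \<inter> unstable_set M d f \<xi> y)"

definition bracket ::
  "'a set \<Rightarrow> ('a \<Rightarrow> 'a \<Rightarrow> real) \<Rightarrow> ('a \<Rightarrow> 'a) \<Rightarrow> real \<Rightarrow> 'a \<Rightarrow> 'a \<Rightarrow> 'a" where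
  "bracket M d f \<xi> x y = the_elem (stable_set M d f \<xi> x \<inter> unstable_set M d f \<xi> y)"

definition box_set ::
  "'a set \<Rightarrow> ('a \<Rightarrow> 'a \<Rightarrow> real) \<Rightarrow> ('a \<Rightarrow> 'a) \<Rightarrow> real \<Rightarrow> real \<Rightarrow> 'a \<Rightarrow> 'a set" where
  "box_set M d f \<xi> r q =
     {bracket M d f \<xi> y x | x y. x \<in> stable_set M d f r q \<and> y \<in> unstable_set M d f r q}"

text \<open>
  The two bracket conditions are what the requirement that \<open>r\<close> be small amounts to: the brackets
  forming the box exist, and so do all brackets between points of the box. The latter include
  the intersections \<open>x\<^sup>s = [p, x]\<close> and \<open>x\<^sup>u = [x, p]\<close> for \<open>p\<close> and \<open>x\<close> in the box.
\<close>

definition product_box ::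
  "'a set \<Rightarrow> ('a \<Rightarrow> 'a \<Rightarrow> real) \<Rightarrow> ('a \<Rightarrow> 'a) \<Rightarrow> real \<Rightarrow> 'a set \<Rightarrow> bool" where
  "product_box M d f \<xi> C \<longleftrightarrow>
     (\<exists>q\<in>M. \<exists>r>0. C = box_set M d f \<xi> r q \<and>
        (\<forall>x \<in> stable_set M d f r q. \<forall>y \<in> unstable_set M d f r q. bracket_defined M d f \<xi> y x) \<and>
        (\<forall>x\<in>C. \<forall>y\<in>C. bracket_defined M d f \<xi> x y))"

definition s_coord ::
  "'a set \<Rightarrow> ('a \<Rightarrow> 'a \<Rightarrow> real) \<Rightarrow> ('a \<Rightarrow> 'a) \<Rightarrow> real \<Rightarrow> 'a \<Rightarrow> 'a \<Rightarrow> 'a" where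
  "s_coord M d f \<xi> p x = the_elem (stable_set M d f \<xi> p \<inter> unstable_set M d f \<xi> x)"

definition u_coord ::
  "'a set \<Rightarrow> ('a \<Rightarrow> 'a \<Rightarrow> real) \<Rightarrow> ('a \<Rightarrow> 'a) \<Rightarrow> real \<Rightarrow> 'a \<Rightarrow> 'a \<Rightarrow> 'a" where
  "u_coord M d f \<xi> p x = the_elem (unstable_set M d f \<xi> p \<inter> stable_set M d f \<xi> x)"

definition box_metric ::
  "'a set \<Rightarrow> ('a \<Rightarrow> 'a \<Rightarrow> real) \<Rightarrow> ('a \<Rightarrow> 'a) \<Rightarrow> real \<Rightarrow> 'a \<Rightarrow> 'a \<Rightarrow> 'a \<Rightarrow> real" where
  "box_metric M d f \<xi> p x y =
     max (d (s_coord M d f \<xi> p x) (s_coord M d f \<xi> p y))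
         (d (u_coord M d f \<xi> p x) (u_coord M d f \<xi> p y))"

definition pseudo_isometry ::
  "'a set \<Rightarrow> ('a \<Rightarrow> 'a \<Rightarrow> real) \<Rightarrow> 'b set \<Rightarrow> ('b \<Rightarrow> 'b \<Rightarrow> real) \<Rightarrow> ('a \<Rightarrow> 'b) \<Rightarrow> bool" where
  "pseudo_isometry X1 d1 X2 d2 h \<longleftrightarrow>
     Metric_space X1 d1 \<and> Metric_space X2 d2 \<and>
     homeomorphic_map (Metric_space.mtopology X1 d1) (Metric_space.mtopology X2 d2) h \<and>
     (\<forall>\<epsilon>>0. \<exists>\<delta>>0. \<forall>x\<in>X1. \<forall>y\<in>X1. 0 < d1 x y \<and> d1 x y < \<delta> \<longrightarrow>
        \<bar>d2 (h x) (h y) / d1 x y - 1\<bar> < \<epsilon>)"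

definition pseudo_isometric ::
  "'a set \<Rightarrow> ('a \<Rightarrow> 'a \<Rightarrow> real) \<Rightarrow> 'b set \<Rightarrow> ('b \<Rightarrow> 'b \<Rightarrow> real) \<Rightarrow> bool" where
  "pseudo_isometric X1 d1 X2 d2 \<longleftrightarrow> (\<exists>h. pseudo_isometry X1 d1 X2 d2 h)"

end

theory Submission
  imports Defs
begin

text \<open>
  The identity of \<open>C\<close> is the pseudo isometry.

  Self-similarity has a long-time form: as long as \<open>\<kappa>\<^sup>n d(x,y)\<close> is at most \<open>\<eta>\<close>, the larger of the
  distances of \<open>x\<close> and \<open>y\<close> at times \<open>n\<close> and \<open>-n\<close> is exactly \<open>\<kappa>\<^sup>n d(x,y)\<close>
  (\<open>self_similar_sequence_iterate\<close>), because distances that have begun to grow in one direction of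
  time keep growing in it. Two points of one local unstable set have a bounded past, so they can grow
  only towards the future, and their distance at time \<open>n\<close> is \<open>\<kappa>\<^sup>n\<close> times their distance
  (\<open>unstable_coordinates_expand\<close>). On the other hand \<open>x\<close> and \<open>x\<^sup>u\<close> lie on one local stable set, so
  their orbits approach each other in the future, uniformly in \<open>x\<close>
  (\<open>unstable_coordinate_asymptotic\<close>). Hence \<open>\<kappa>\<^sup>n d(x\<^sup>u,y\<^sup>u)\<close> differs from the distance of \<open>x\<close> and
  \<open>y\<close> at time \<open>n\<close> by an error that tends to \<open>0\<close>, and, with time reversed, \<open>\<kappa>\<^sup>n d(x\<^sup>s,y\<^sup>s)\<close> differs
  as little from their distance at time \<open>-n\<close>.

  Taking maxima, \<open>\<kappa>\<^sup>n d\<^sub>p(x,y)\<close> and \<open>\<kappa>\<^sup>n d(x,y)\<close> differ by at most this error. If \<open>n\<close> is the last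
  time for which \<open>\<kappa>\<^sup>n d(x,y)\<close> is below a fixed threshold, then \<open>\<kappa>\<^sup>n d(x,y)\<close> is also bounded away from
  \<open>0\<close>, so division turns the small error into a ratio close to \<open>1\<close>; and \<open>n\<close> is large when \<open>d(x,y)\<close> is
  small (\<open>product_coordinates_ratio\<close>).

  This estimate makes the identity continuous from \<open>d\<close> to \<open>d\<^sub>p\<close>. For the inverse, two points whose
  coordinates are close have orbits within \<open>3\<xi>\<close> of each other for a long time, and therefore are
  close, by uniform expansivity (\<open>product_coordinates_determine\<close>).
\<close>

section \<open>Sequences with self-similar growth\<close>

text \<open>
  The model is \<open>a i = d (f\<^sup>i x) (f\<^sup>i y)\<close> for a self-similar metric with expanding factor \<open>\<kappa>\<close> and
  expansive constant \<open>\<eta>\<close>.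
\<close>

definition self_similar_sequence :: "real \<Rightarrow> real \<Rightarrow> (int \<Rightarrow> real) \<Rightarrow> bool" where
  "self_similar_sequence \<kappa> \<eta> a \<longleftrightarrow>
     (\<forall>i. 0 \<le> a i) \<and> (\<forall>i. a i \<le> \<eta> \<longrightarrow> max (a (i + 1)) (a (i - 1)) = \<kappa> * a i)"

lemma self_similar_sequence_reflect:
  assumes "self_similar_sequence \<kappa> \<eta> a"
  shows "self_similar_sequence \<kappa> \<eta> (\<lambda>i. a (- i))"
  unfolding self_similar_sequence_def
proof (intro conjI allI impI)
  fix i assume "a (- i) \<le> \<eta>"
  then have "max (a (- i + 1)) (a (- i - 1)) = \<kappa> * a (- i)"
    using assms unfolding self_similar_sequence_def by blast
  moreover have "- (i + 1) = - i - 1" "- (i - 1) = - i + 1" by auto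
  ultimately show "max (a (- (i + 1))) (a (- (i - 1))) = \<kappa> * a (- i)"
    by (simp only: max.commute)
qed (use assms in \<open>simp add: self_similar_sequence_def\<close>)

lemma self_similar_sequence_upper_bound:
  assumes a: "self_similar_sequence \<kappa> \<eta> a" and "\<kappa> > 1" and "\<kappa> ^ n * a 0 \<le> \<eta>"
  shows "a (int n) \<le> \<kappa> ^ n * a 0"
  using assms(3)
proof (induction n)
  case (Suc n)
  have nonneg: "0 \<le> \<kappa> ^ n * a 0"
    using a \<open>\<kappa> > 1\<close> by (simp add: self_similar_sequence_def)
  then have "1 * (\<kappa> ^ n * a 0) \<le> \<kappa> * (\<kappa> ^ n * a 0)"
    using \<open>\<kappa> > 1\<close> by (intro mult_right_mono) auto
  then have small: "\<kappa> ^ n * a 0 \<le> \<eta>"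
    using Suc.prems by (simp add: mult.assoc)
  have IH: "a (int n) \<le> \<kappa> ^ n * a 0" using Suc.IH[OF small] .
  with small have "max (a (int n + 1)) (a (int n - 1)) = \<kappa> * a (int n)"
    using a unfolding self_similar_sequence_def by (meson order.trans)
  then have "a (int n + 1) \<le> \<kappa> * a (int n)" by linarith
  also have "\<dots> \<le> \<kappa> * (\<kappa> ^ n * a 0)" using IH \<open>\<kappa> > 1\<close> by (intro mult_left_mono) auto
  finally show ?case by (simp add: mult.assoc add.commute)
qed simp

text \<open>
  A term that has just grown by the factor \<open>\<kappa>\<close> dominates its predecessor, so the maximum in the
  recursion is again attained at the successor.
\<close>

lemma self_similar_sequence_growth_persists:
  assumes a: "self_similar_sequence \<kappa> \<eta> a" and "\<kappa> > 1" and step: "a 1 = \<kappa> * a 0"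
    and small: "\<And>k. k < n \<Longrightarrow> a (int k) \<le> \<eta>"
  shows "a (int n) = \<kappa> ^ n * a 0"
proof -
  have grow: "a (int k + 1) = \<kappa> * a (int k)" if "k < n" for k
    using that
  proof (induction k)
    case 0
    then show ?case using step by simp
  next
    case (Suc k)
    have IH: "a (int (Suc k)) = \<kappa> * a (int k)" using Suc by (simp add: add.commute)
    have max: "max (a (int (Suc k) + 1)) (a (int k)) = \<kappa> * a (int (Suc k))"
      using a small[OF Suc.prems] unfolding self_similar_sequence_def
      by (metis add_diff_cancel_right' of_nat_Suc add.commute)
    have nonneg: "0 \<le> a i" for i using a by (simp add: self_similar_sequence_def)
    show ?case
    proof (cases "a (int k) = 0")
      case True
      then show ?thesis using max IH nonneg[of "int (Suc k) + 1"] by simp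
    next
      case False
      have sq: "\<kappa> * \<kappa> > 1" using \<open>\<kappa> > 1\<close> by (simp add: less_1_mult)
      have "a (int k) > 0" using False nonneg[of "int k"] by linarith
      then have "1 * a (int k) < (\<kappa> * \<kappa>) * a (int k)"
        using sq by (intro mult_strict_right_mono) auto
      then have "a (int k) < \<kappa> * a (int (Suc k))" unfolding IH by (simp add: mult.assoc)
      then show ?thesis using max by linarith
    qed
  qed
  have "a (int k) = \<kappa> ^ k * a 0" if "k \<le> n" for k
    using that
  proof (induction k)
    case (Suc k)
    then show ?case using grow[of k] by (simp add: mult.assoc add.commute)
  qed simp
  then show ?thesis by simp
qed

text \<open>
  At time \<open>0\<close> the sequence grows by the factor \<open>\<kappa>\<close> in at least one direction, and then continues to
  do so; the other direction cannot grow faster.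
\<close>

lemma self_similar_sequence_iterate:
  assumes a: "self_similar_sequence \<kappa> \<eta> a" and "\<kappa> > 1" and small: "\<kappa> ^ n * a 0 \<le> \<eta>"
  shows "max (a (int n)) (a (- int n)) = \<kappa> ^ n * a 0"
proof -
  have nonneg: "0 \<le> a 0" using a by (simp add: self_similar_sequence_def)
  have small_le: "\<kappa> ^ k * a 0 \<le> \<eta>" if "k \<le> n" for k
  proof -
    have "\<kappa> ^ k \<le> \<kappa> ^ n" using that \<open>\<kappa> > 1\<close> by (simp add: power_increasing)
    then show ?thesis using small nonneg by (meson mult_right_mono order.trans)
  qed
  have up: "a (int k) \<le> \<kappa> ^ k * a 0" "a (- int k) \<le> \<kappa> ^ k * a 0" if "k \<le> n" for k
    using self_similar_sequence_upper_bound[OF a \<open>\<kappa> > 1\<close> small_le[OF that]]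
      self_similar_sequence_upper_bound[OF self_similar_sequence_reflect[OF a] \<open>\<kappa> > 1\<close>, of k]
      small_le[OF that] by auto
  have "max (a 1) (a (-1)) = \<kappa> * a 0"
    using a small_le[of 0] unfolding self_similar_sequence_def
    by (metis add_0 diff_0 le0 mult_1 power_0)
  then consider "a 1 = \<kappa> * a 0" | "a (-1) = \<kappa> * a 0" by linarith
  then have "a (int n) = \<kappa> ^ n * a 0 \<or> a (- int n) = \<kappa> ^ n * a 0"
  proof cases
    case 1
    have "a (int k) \<le> \<eta>" if "k < n" for k
      using up(1)[of k] small_le[of k] that by linarith
    then show ?thesis using self_similar_sequence_growth_persists[OF a \<open>\<kappa> > 1\<close> 1] by blast
  next
    case 2
    have "a (- int k) \<le> \<eta>" if "k < n" for k
      using up(2)[of k] small_le[of k] that by linarith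
    then have "a (- int n) = \<kappa> ^ n * a (- 0)"
      using self_similar_sequence_growth_persists[OF self_similar_sequence_reflect[OF a] \<open>\<kappa> > 1\<close>,
          of n] 2 by simp
    then show ?thesis by simp
  qed
  then show ?thesis using up[of n] by linarith
qed

text \<open>
  Growth towards the past would be exponential for ever, contrary to the bound on the past;
  hence the sequence grows towards the future.
\<close>

lemma self_similar_sequence_bounded_past:
  assumes a: "self_similar_sequence \<kappa> \<eta> a" and "\<kappa> > 1"
    and past: "\<And>m. a (- int m) \<le> \<eta>" and small: "\<And>k. k < n \<Longrightarrow> a (int k) \<le> \<eta>"
  shows "a (int n) = \<kappa> ^ n * a 0"
proof -
  have nonneg: "0 \<le> a i" for i using a by (simp add: self_similar_sequence_def)
  have max_eq: "max (a 1) (a (-1)) = \<kappa> * a 0"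
    using a past[of 0] unfolding self_similar_sequence_def
    by (metis add_0 diff_0 minus_zero of_nat_0)
  have "a 1 = \<kappa> * a 0"
  proof (rule ccontr)
    assume "a 1 \<noteq> \<kappa> * a 0"
    with max_eq have before: "a (-1) = \<kappa> * a 0" and "a 1 < \<kappa> * a 0" by linarith+
    then have "\<kappa> * a 0 > 0" using nonneg[of 1] by linarith
    then have pos: "a 0 > 0" using \<open>\<kappa> > 1\<close> by (simp add: zero_less_mult_iff)
    have "\<kappa> ^ m * a 0 \<le> \<eta>" for m
      using self_similar_sequence_growth_persists[OF self_similar_sequence_reflect[OF a] \<open>\<kappa> > 1\<close>,
          of m] before past past[of m] by simp
    moreover obtain m where "\<eta> / a 0 < \<kappa> ^ m" using real_arch_pow[OF \<open>\<kappa> > 1\<close>] by blast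
    ultimately show False using pos by (metis divide_less_eq not_less)
  qed
  then show ?thesis
    using self_similar_sequence_growth_persists[OF a \<open>\<kappa> > 1\<close>] small by blast
qed

section \<open>Expansive self-similar actions of the integers\<close>

text \<open>
  For \<open>F i = f\<^sup>i\<close> the condition is \<open>u \<in> W\<^sup>u\<^sub>\<xi>(p) \<inter> W\<^sup>s\<^sub>\<xi>(x)\<close>. It takes the whole action \<open>F\<close> as an argument
  so that the reversed action \<open>F (- i)\<close> turns it into the stable coordinate, and every statement about
  unstable coordinates into its stable counterpart.
\<close>

definition unstable_coordinate ::
  "'a set \<Rightarrow> ('a \<Rightarrow> 'a \<Rightarrow> real) \<Rightarrow> (int \<Rightarrow> 'a \<Rightarrow> 'a) \<Rightarrow> real \<Rightarrow> 'a \<Rightarrow> 'a \<Rightarrow> 'a \<Rightarrow> bool" where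
  "unstable_coordinate M d F \<xi> p x u \<longleftrightarrow> p \<in> M \<and> x \<in> M \<and> u \<in> M \<and>
     (\<forall>i\<le>0. d (F i p) (F i u) \<le> \<xi>) \<and> (\<forall>i\<ge>0. d (F i x) (F i u) \<le> \<xi>)"

locale self_similar_action = Metric_space M d
  for M :: "'a set" and d :: "'a \<Rightarrow> 'a \<Rightarrow> real" +
  fixes F :: "int \<Rightarrow> 'a \<Rightarrow> 'a" and \<eta> \<kappa> \<xi> :: real
  assumes compact: "compact_space mtopology"
    and F_closed: "x \<in> M \<Longrightarrow> F i x \<in> M"
    and F_zero: "x \<in> M \<Longrightarrow> F 0 x = x"
    and F_add: "x \<in> M \<Longrightarrow> F (i + j) x = F i (F j x)"
    and eta_pos: "\<eta> > 0" and kappa_gt_1: "\<kappa> > 1" and xi_pos: "\<xi> > 0"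
    and self_similar: "\<lbrakk>x \<in> M; y \<in> M; d x y \<le> \<eta>\<rbrakk> \<Longrightarrow>
       max (d (F 1 x) (F 1 y)) (d (F (-1) x) (F (-1) y)) = \<kappa> * d x y"
    and expansive_action: "\<lbrakk>x \<in> M; y \<in> M; \<And>i. d (F i x) (F i y) \<le> 3 * \<xi>\<rbrakk> \<Longrightarrow> x = y"
begin

lemma reflected: "self_similar_action M d (\<lambda>i. F (- i)) \<eta> \<kappa> \<xi>"
proof unfold_locales
  fix x i j assume "x \<in> M"
  then show "F (- (i + j)) x = F (- i) (F (- j) x)"
    using F_add[of x "- i" "- j"] by (simp add: add.commute)
next
  fix x y assume xy: "x \<in> M" "y \<in> M" and "\<And>i. d (F (- i) x) (F (- i) y) \<le> 3 * \<xi>"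
  then have "d (F i x) (F i y) \<le> 3 * \<xi>" for i by (metis minus_minus)
  then show "x = y" using expansive_action xy by blast
qed (use compact F_closed F_zero eta_pos kappa_gt_1 xi_pos self_similar in
      \<open>auto simp: max.commute\<close>)

lemma orbit_distance_self_similar:
  assumes "x \<in> M" "y \<in> M"
  shows "self_similar_sequence \<kappa> \<eta> (\<lambda>i. d (F i x) (F i y))"
  unfolding self_similar_sequence_def
proof (intro conjI allI impI)
  fix i assume "d (F i x) (F i y) \<le> \<eta>"
  then have "max (d (F 1 (F i x)) (F 1 (F i y))) (d (F (-1) (F i x)) (F (-1) (F i y))) =
      \<kappa> * d (F i x) (F i y)"
    using self_similar F_closed assms by blast
  moreover have "F 1 (F i z) = F (i + 1) z" "F (-1) (F i z) = F (i - 1) z" if "z \<in> M" for z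
    using F_add[OF that, of 1 i] F_add[OF that, of "-1" i] by (simp_all add: add.commute)
  ultimately show "max (d (F (i + 1) x) (F (i + 1) y)) (d (F (i - 1) x) (F (i - 1) y)) =
      \<kappa> * d (F i x) (F i y)"
    using assms by simp
qed simp

lemma orbit_distance_upper_bound:
  assumes xy: "x \<in> M" "y \<in> M" and "\<kappa> ^ n * d x y \<le> \<eta>" and "\<bar>i\<bar> \<le> int n"
  shows "d (F i x) (F i y) \<le> \<kappa> ^ n * d x y"
proof -
  have pow: "\<kappa> ^ nat \<bar>i\<bar> \<le> \<kappa> ^ n" using kappa_gt_1 assms(4) by (intro power_increasing) auto
  then have le: "\<kappa> ^ nat \<bar>i\<bar> * d x y \<le> \<kappa> ^ n * d x y" by (simp add: mult_right_mono)
  have "max (d (F (int (nat \<bar>i\<bar>)) x) (F (int (nat \<bar>i\<bar>)) y))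
      (d (F (- int (nat \<bar>i\<bar>)) x) (F (- int (nat \<bar>i\<bar>)) y)) = \<kappa> ^ nat \<bar>i\<bar> * d x y"
    using self_similar_sequence_iterate[OF orbit_distance_self_similar[OF xy] kappa_gt_1, of "nat \<bar>i\<bar>"]
      le assms(3) xy F_zero by simp
  then have "d (F i x) (F i y) \<le> \<kappa> ^ nat \<bar>i\<bar> * d x y"
    by (cases "i \<ge> 0") (auto simp: max_def split: if_splits)
  then show ?thesis using le by linarith
qed

text \<open>Self-similarity makes \<open>F i\<close> expand small distances at most by the factor \<open>\<kappa>\<^bsup>|i|\<^esup>\<close>.\<close>

lemma F_continuous: "continuous_map mtopology mtopology (F i)"
  unfolding metric_continuous_map[OF Metric_space_axioms]
proof (intro conjI ballI allI impI)
  show "F i ` M \<subseteq> M" using F_closed by auto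
  fix x and \<epsilon> :: real assume x: "x \<in> M" and "\<epsilon> > 0"
  define \<delta> where "\<delta> = min \<epsilon> \<eta> / \<kappa> ^ nat \<bar>i\<bar>"
  have pow: "\<kappa> ^ nat \<bar>i\<bar> > 0" using kappa_gt_1 by simp
  have "\<delta> > 0" using \<open>\<epsilon> > 0\<close> eta_pos pow by (simp add: \<delta>_def)
  moreover have "d (F i x) (F i y) < \<epsilon>" if "y \<in> M" "d x y < \<delta>" for y
  proof -
    have "\<kappa> ^ nat \<bar>i\<bar> * d x y < min \<epsilon> \<eta>"
      using that(2) pow by (simp add: \<delta>_def pos_less_divide_eq mult.commute)
    then show ?thesis using orbit_distance_upper_bound[OF x that(1), of "nat \<bar>i\<bar>" i] by simp
  qed
  ultimately show "\<exists>\<delta>>0. \<forall>y. y \<in> M \<and> d x y < \<delta> \<longrightarrow> d (F i x) (F i y) < \<epsilon>" by blast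
qed

text \<open>
  The pairs at distance at least \<open>\<alpha>\<close> that stay \<open>3\<xi>\<close>-close for times up to \<open>N\<close> form a decreasing
  sequence of closed subsets of the compact square of \<open>M\<close>. Expansivity says that no pair lies in all
  of them, so one of them is empty.
\<close>

lemma uniform_expansivity:
  assumes "\<alpha> > 0"
  shows "\<exists>N::nat. \<forall>u\<in>M. \<forall>v\<in>M. (\<forall>i. \<bar>i\<bar> \<le> int N \<longrightarrow> d (F i u) (F i v) \<le> 3 * \<xi>) \<longrightarrow> d u v < \<alpha>"
proof (rule ccontr)
  assume contra: "\<not> ?thesis"
  define X where "X = prod_topology mtopology mtopology"
  define K where "K N = {z \<in> M \<times> M. d (fst z) (snd z) \<ge> \<alpha> \<and>
     (\<forall>i. \<bar>i\<bar> \<le> int N \<longrightarrow> d (F i (fst z)) (F i (snd z)) \<le> 3 * \<xi>)}" for N :: nat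
  have top: "topspace X = M \<times> M" by (simp add: X_def)
  have cont: "continuous_map X euclideanreal (\<lambda>z. d (F i (fst z)) (F i (snd z)))" for i
  proof -
    have "continuous_map X mtopology (\<lambda>z. F i (fst z))" "continuous_map X mtopology (\<lambda>z. F i (snd z))"
      using continuous_map_compose[OF continuous_map_fst F_continuous]
        continuous_map_compose[OF continuous_map_snd F_continuous]
      by (auto simp: X_def comp_def)
    then show ?thesis
      using continuous_map_mdist[of X "metric (M, d)" "\<lambda>z. F i (fst z)" "\<lambda>z. F i (snd z)"]
      by (simp add: mtopology_of)
  qed
  have closed_le: "closedin X {z \<in> M \<times> M. d (F i (fst z)) (F i (snd z)) \<le> 3 * \<xi>}" for i
    using closedin_continuous_map_preimage[OF cont, of "{..3 * \<xi>}" i] by (simp add: top)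
  have "closedin X {z \<in> M \<times> M. d (F 0 (fst z)) (F 0 (snd z)) \<in> {\<alpha>..}}"
    using closedin_continuous_map_preimage[OF cont, of "{\<alpha>..}" 0] by (simp add: top)
  moreover have "{z \<in> M \<times> M. d (F 0 (fst z)) (F 0 (snd z)) \<in> {\<alpha>..}} =
      {z \<in> M \<times> M. d (fst z) (snd z) \<ge> \<alpha>}"
    using F_zero by auto
  ultimately have closed_ge: "closedin X {z \<in> M \<times> M. d (fst z) (snd z) \<ge> \<alpha>}" by simp
  have "K N = {z \<in> M \<times> M. d (fst z) (snd z) \<ge> \<alpha>} \<inter>
      (\<Inter>i\<in>{i. \<bar>i\<bar> \<le> int N}. {z \<in> M \<times> M. d (F i (fst z)) (F i (snd z)) \<le> 3 * \<xi>})" for N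
    unfolding K_def by auto
  moreover have "closedin X (\<Inter>i\<in>{i. \<bar>i\<bar> \<le> int N}.
      {z \<in> M \<times> M. d (F i (fst z)) (F i (snd z)) \<le> 3 * \<xi>})" for N
  proof (rule closedin_Inter)
    have "0 \<in> {i. \<bar>i\<bar> \<le> int N}" by simp
    then show "(\<lambda>i. {z \<in> M \<times> M. d (F i (fst z)) (F i (snd z)) \<le> 3 * \<xi>}) ` {i. \<bar>i\<bar> \<le> int N} \<noteq> {}"
      by blast
  qed (use closed_le in auto)
  ultimately have "closedin X (K N)" for N
    using closed_ge by (simp add: closedin_Int)
  moreover have "K N \<noteq> {}" for N
  proof -
    obtain u v where "u \<in> M" "v \<in> M" "\<not> d u v < \<alpha>"
      "\<forall>i. \<bar>i\<bar> \<le> int N \<longrightarrow> d (F i u) (F i v) \<le> 3 * \<xi>"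
      using contra by blast
    then have "(u, v) \<in> K N" by (simp add: K_def)
    then show ?thesis by blast
  qed
  moreover have "decseq K" unfolding K_def decseq_def by force
  moreover have "compact_space X" by (simp add: X_def compact_space_prod_topology compact)
  ultimately have "(\<Inter>N. K N) \<noteq> {}" by (intro compact_space_imp_nest)
  then obtain z where "z \<in> (\<Inter>N. K N)" by (meson ex_in_conv)
  then have z: "z \<in> K N" for N by simp
  have "d (F i (fst z)) (F i (snd z)) \<le> 3 * \<xi>" for i
    using z[of "nat \<bar>i\<bar>"] unfolding K_def by auto
  then have "fst z = snd z"
    using z[of 0] expansive_action unfolding K_def by (auto simp: mem_Times_iff)
  moreover have "fst z \<in> M" "d (fst z) (snd z) \<ge> \<alpha>" using z[of 0] by (auto simp: K_def)
  ultimately show False using \<open>\<alpha> > 0\<close> by simp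
qed

section \<open>Coordinates along the two local sets of a base point\<close>

lemma unstable_coordinates_past:
  assumes "unstable_coordinate M d F \<xi> p x u" "unstable_coordinate M d F \<xi> p y v" "i \<le> 0"
  shows "d (F i u) (F i v) \<le> 2 * \<xi>"
proof -
  have "d (F i u) (F i v) \<le> d (F i p) (F i u) + d (F i p) (F i v)"
    using assms(1,2) F_closed unfolding unstable_coordinate_def by (intro triangle'') auto
  moreover have "d (F i p) (F i u) \<le> \<xi>" "d (F i p) (F i v) \<le> \<xi>"
    using assms unfolding unstable_coordinate_def by auto
  ultimately show ?thesis by linarith
qed

lemma quadrilateral:
  assumes "x \<in> M" "u \<in> M" "y \<in> M" "v \<in> M"
  shows "\<bar>d u v - d x y\<bar> \<le> d x u + d y v"
proof -
  have "d u v \<le> d u x + d x v" "d x v \<le> d x y + d y v"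
    "d x y \<le> d x u + d u y" "d u y \<le> d u v + d v y"
    using assms triangle by blast+
  then show ?thesis using commute[of u x] commute[of v y] by linarith
qed

lemma unstable_coordinates_future:
  assumes "unstable_coordinate M d F \<xi> p x u" "unstable_coordinate M d F \<xi> p y v" "i \<ge> 0"
  shows "\<bar>d (F i u) (F i v) - d (F i x) (F i y)\<bar> \<le> 2 * \<xi>"
proof -
  have "\<bar>d (F i u) (F i v) - d (F i x) (F i y)\<bar> \<le> d (F i x) (F i u) + d (F i y) (F i v)"
    using assms F_closed unfolding unstable_coordinate_def by (intro quadrilateral) auto
  moreover have "d (F i x) (F i u) \<le> \<xi>" "d (F i y) (F i v) \<le> \<xi>"
    using assms unfolding unstable_coordinate_def by auto
  ultimately show ?thesis by linarith
qed

text \<open>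
  Seen from time \<open>n\<close>, the orbits of a point and of its coordinate are \<open>\<xi>\<close>-close on the window from
  \<open>-n\<close> to \<open>n\<close>, to which uniform expansivity applies.
\<close>

lemma unstable_coordinate_asymptotic:
  assumes "\<alpha> > 0"
  shows "\<exists>N. \<forall>n\<ge>N. \<forall>p x u. unstable_coordinate M d F \<xi> p x u \<longrightarrow>
     d (F (int n) x) (F (int n) u) < \<alpha>"
proof -
  obtain N where N: "\<And>u v. \<lbrakk>u \<in> M; v \<in> M; \<And>i. \<bar>i\<bar> \<le> int N \<Longrightarrow> d (F i u) (F i v) \<le> 3 * \<xi>\<rbrakk>
      \<Longrightarrow> d u v < \<alpha>"
    using uniform_expansivity[OF assms] by blast
  have "d (F (int n) x) (F (int n) u) < \<alpha>"
    if "n \<ge> N" and c: "unstable_coordinate M d F \<xi> p x u" for n p x u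
  proof (rule N)
    have M: "x \<in> M" "u \<in> M" using c by (auto simp: unstable_coordinate_def)
    then show "F (int n) x \<in> M" "F (int n) u \<in> M" using F_closed by auto
    fix i assume "\<bar>i\<bar> \<le> int N"
    then have "i + int n \<ge> 0" using \<open>n \<ge> N\<close> by linarith
    then have "d (F (i + int n) x) (F (i + int n) u) \<le> \<xi>"
      using c by (auto simp: unstable_coordinate_def)
    then show "d (F i (F (int n) x)) (F i (F (int n) u)) \<le> 3 * \<xi>"
      using F_add M xi_pos by simp
  qed
  then show ?thesis by blast
qed

text \<open>
  Exact expansion needs \<open>u\<close> and \<open>v\<close> to be \<open>\<eta>\<close>-close at all times up to \<open>n\<close>. The coordinates only give
  \<open>2\<xi>\<close>-closeness in the past and, in the future, closeness within \<open>2\<xi>\<close> more than the distance of \<open>x\<close> and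
  \<open>y\<close>; and \<open>\<xi>\<close> may exceed \<open>\<eta>\<close>. Uniform expansivity closes this gap: \<open>\<eta>\<close>-closeness at one time follows
  from \<open>3\<xi>\<close>-closeness on a window of fixed radius \<open>N\<close> around it, and \<open>\<tau>\<close> is chosen so that \<open>x\<close> and \<open>y\<close>
  are \<open>\<xi>\<close>-close at all times from \<open>0\<close> to \<open>n + N\<close>.
\<close>

lemma unstable_coordinates_expand:
  "\<exists>\<tau>>0. \<tau> \<le> \<eta> \<and> (\<forall>n p x u y v. unstable_coordinate M d F \<xi> p x u \<longrightarrow>
     unstable_coordinate M d F \<xi> p y v \<longrightarrow> \<kappa> ^ n * d x y \<le> \<tau> \<longrightarrow>
     d (F (int n) u) (F (int n) v) = \<kappa> ^ n * d u v)"
proof -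
  obtain N where N: "\<And>u v. \<lbrakk>u \<in> M; v \<in> M; \<And>i. \<bar>i\<bar> \<le> int N \<Longrightarrow> d (F i u) (F i v) \<le> 3 * \<xi>\<rbrakk>
      \<Longrightarrow> d u v < \<eta>"
    using uniform_expansivity[OF eta_pos] by blast
  define \<tau> where "\<tau> = min \<xi> \<eta> / \<kappa> ^ N"
  have powN: "\<kappa> ^ N \<ge> 1" using kappa_gt_1 by simp
  have "\<tau> > 0" using xi_pos eta_pos powN by (simp add: \<tau>_def)
  moreover have "\<tau> \<le> \<eta>"
  proof -
    have "min \<xi> \<eta> * 1 \<le> min \<xi> \<eta> * \<kappa> ^ N"
      using powN xi_pos eta_pos by (intro mult_left_mono) auto
    then have "\<tau> \<le> min \<xi> \<eta>"
      unfolding \<tau>_def using powN by (subst pos_divide_le_eq) linarith+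
    then show ?thesis by simp
  qed
  moreover have "d (F (int n) u) (F (int n) v) = \<kappa> ^ n * d u v"
    if cx: "unstable_coordinate M d F \<xi> p x u" and cy: "unstable_coordinate M d F \<xi> p y v"
      and "\<kappa> ^ n * d x y \<le> \<tau>" for n p x u y v
  proof -
    have M: "x \<in> M" "y \<in> M" "u \<in> M" "v \<in> M" using cx cy by (auto simp: unstable_coordinate_def)
    have bound: "\<kappa> ^ (n + N) * d x y \<le> min \<xi> \<eta>"
      using that(3) powN by (simp add: \<tau>_def pos_le_divide_eq power_add mult_ac)
    have small: "d (F k u) (F k v) < \<eta>" if "k \<le> int n" for k
    proof (rule N)
      show "F k u \<in> M" "F k v \<in> M" using M F_closed by auto
      fix i assume "\<bar>i\<bar> \<le> int N"
      have "d (F (i + k) u) (F (i + k) v) \<le> 3 * \<xi>"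
      proof (cases "i + k \<ge> 0")
        case True
        have "d (F (i + k) x) (F (i + k) y) \<le> \<kappa> ^ (n + N) * d x y"
          using bound True \<open>\<bar>i\<bar> \<le> int N\<close> \<open>k \<le> int n\<close> M
          by (intro orbit_distance_upper_bound) auto
        then show ?thesis
          using unstable_coordinates_future[OF cx cy True] bound by linarith
      next
        case False
        then show ?thesis using unstable_coordinates_past[OF cx cy, of "i + k"] xi_pos by linarith
      qed
      then show "d (F i (F k u)) (F i (F k v)) \<le> 3 * \<xi>" using F_add M by simp
    qed
    have "d (F (int n) u) (F (int n) v) = \<kappa> ^ n * d (F 0 u) (F 0 v)"
    proof (rule self_similar_sequence_bounded_past[OF orbit_distance_self_similar kappa_gt_1])
      fix m show "d (F (- int m) u) (F (- int m) v) \<le> \<eta>" using small[of "- int m"] by simp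
    next
      fix k assume "k < n"
      then show "d (F (int k) u) (F (int k) v) \<le> \<eta>" using small[of "int k"] by simp
    qed (use M in auto)
    then show ?thesis using F_zero M by simp
  qed
  ultimately show ?thesis by blast
qed

text \<open>
  The threshold \<open>\<tau>\<close> is chosen before the precision \<open>\<alpha>\<close>: the ratio estimate takes \<open>\<alpha>\<close> to be a small
  multiple of \<open>\<tau>\<close>.
\<close>

lemma unstable_coordinates_shadow:
  "\<exists>\<tau>>0. \<tau> \<le> \<eta> \<and> (\<forall>\<alpha>>0. \<exists>N. \<forall>n\<ge>N. \<forall>p x u y v. unstable_coordinate M d F \<xi> p x u \<longrightarrow>
     unstable_coordinate M d F \<xi> p y v \<longrightarrow> \<kappa> ^ n * d x y \<le> \<tau> \<longrightarrow>
     \<bar>\<kappa> ^ n * d u v - d (F (int n) x) (F (int n) y)\<bar> < \<alpha>)"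
proof -
  obtain \<tau> where \<tau>: "\<tau> > 0" "\<tau> \<le> \<eta>" and expand: "\<And>n p x u y v.
     \<lbrakk>unstable_coordinate M d F \<xi> p x u; unstable_coordinate M d F \<xi> p y v; \<kappa> ^ n * d x y \<le> \<tau>\<rbrakk>
     \<Longrightarrow> d (F (int n) u) (F (int n) v) = \<kappa> ^ n * d u v"
    using unstable_coordinates_expand by blast
  have "\<exists>N. \<forall>n\<ge>N. \<forall>p x u y v. unstable_coordinate M d F \<xi> p x u \<longrightarrow>
     unstable_coordinate M d F \<xi> p y v \<longrightarrow> \<kappa> ^ n * d x y \<le> \<tau> \<longrightarrow>
     \<bar>\<kappa> ^ n * d u v - d (F (int n) x) (F (int n) y)\<bar> < \<alpha>" if "\<alpha> > 0" for \<alpha>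
  proof -
    obtain N where N: "\<And>n p x u. \<lbrakk>n \<ge> N; unstable_coordinate M d F \<xi> p x u\<rbrakk> \<Longrightarrow>
       d (F (int n) x) (F (int n) u) < \<alpha> / 2"
      using unstable_coordinate_asymptotic[OF half_gt_zero[OF \<open>\<alpha> > 0\<close>]] by metis
    have "\<bar>\<kappa> ^ n * d u v - d (F (int n) x) (F (int n) y)\<bar> < \<alpha>"
      if "n \<ge> N" and cx: "unstable_coordinate M d F \<xi> p x u"
        and cy: "unstable_coordinate M d F \<xi> p y v" and "\<kappa> ^ n * d x y \<le> \<tau>" for n p x u y v
    proof -
      have "x \<in> M" "y \<in> M" "u \<in> M" "v \<in> M" using cx cy by (auto simp: unstable_coordinate_def)
      then have "\<bar>d (F (int n) u) (F (int n) v) - d (F (int n) x) (F (int n) y)\<bar>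
          \<le> d (F (int n) x) (F (int n) u) + d (F (int n) y) (F (int n) v)"
        using F_closed by (intro quadrilateral)
      then show ?thesis using N[OF \<open>n \<ge> N\<close> cx] N[OF \<open>n \<ge> N\<close> cy] expand[OF cx cy that(4)] by linarith
    qed
    then show ?thesis by blast
  qed
  then show ?thesis using \<tau> by blast
qed

definition product_coordinates :: "'a \<Rightarrow> 'a \<Rightarrow> 'a \<Rightarrow> 'a \<Rightarrow> bool" where
  "product_coordinates p x s u \<longleftrightarrow>
     unstable_coordinate M d (\<lambda>i. F (- i)) \<xi> p x s \<and> unstable_coordinate M d F \<xi> p x u"

lemma product_coordinates_carrier:
  "product_coordinates p x s u \<Longrightarrow> x \<in> M \<and> s \<in> M \<and> u \<in> M"
  by (simp add: product_coordinates_def unstable_coordinate_def)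

text \<open>
  The comparison takes place at the last time \<open>n\<close> at which \<open>\<kappa>\<^sup>n d(x,y)\<close> does not exceed the threshold
  \<open>\<tau>\<close>. There \<open>\<kappa>\<^sup>n d(x,y) > \<tau> / \<kappa>\<close>, so an absolute error of \<open>\<epsilon> * (\<tau> / \<kappa>)\<close> is a relative error below
  \<open>\<epsilon>\<close>.
\<close>

lemma product_coordinates_ratio:
  assumes "\<epsilon> > 0"
  shows "\<exists>\<delta>>0. \<forall>p x s u y t v. product_coordinates p x s u \<longrightarrow> product_coordinates p y t v \<longrightarrow>
     0 < d x y \<longrightarrow> d x y < \<delta> \<longrightarrow> \<bar>max (d s t) (d u v) / d x y - 1\<bar> < \<epsilon>"
proof -
  obtain \<tau>\<^sub>u where \<tau>\<^sub>u: "\<tau>\<^sub>u > 0" "\<tau>\<^sub>u \<le> \<eta>" and unstable: "\<And>\<alpha>. \<alpha> > 0 \<Longrightarrow> \<exists>N. \<forall>n\<ge>N. \<forall>p x u y v.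
     unstable_coordinate M d F \<xi> p x u \<longrightarrow> unstable_coordinate M d F \<xi> p y v \<longrightarrow>
     \<kappa> ^ n * d x y \<le> \<tau>\<^sub>u \<longrightarrow> \<bar>\<kappa> ^ n * d u v - d (F (int n) x) (F (int n) y)\<bar> < \<alpha>"
    using unstable_coordinates_shadow by blast
  obtain \<tau>\<^sub>s where \<tau>\<^sub>s: "\<tau>\<^sub>s > 0" "\<tau>\<^sub>s \<le> \<eta>" and stable: "\<And>\<alpha>. \<alpha> > 0 \<Longrightarrow> \<exists>N. \<forall>n\<ge>N. \<forall>p x s y t.
     unstable_coordinate M d (\<lambda>i. F (- i)) \<xi> p x s \<longrightarrow>
     unstable_coordinate M d (\<lambda>i. F (- i)) \<xi> p y t \<longrightarrow>
     \<kappa> ^ n * d x y \<le> \<tau>\<^sub>s \<longrightarrow> \<bar>\<kappa> ^ n * d s t - d (F (- int n) x) (F (- int n) y)\<bar> < \<alpha>"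
    using self_similar_action.unstable_coordinates_shadow[OF reflected] by blast
  define \<tau> where "\<tau> = min \<tau>\<^sub>u \<tau>\<^sub>s"
  have \<tau>: "\<tau> > 0" "\<tau> \<le> \<eta>" "\<tau> \<le> \<tau>\<^sub>u" "\<tau> \<le> \<tau>\<^sub>s" using \<tau>\<^sub>u \<tau>\<^sub>s by (auto simp: \<tau>_def)
  define \<alpha> where "\<alpha> = \<epsilon> * (\<tau> / \<kappa>)"
  have "\<alpha> > 0" using assms \<tau> kappa_gt_1 by (simp add: \<alpha>_def)
  obtain N1 where N1: "\<And>n p x u y v. \<lbrakk>n \<ge> N1; unstable_coordinate M d F \<xi> p x u;
     unstable_coordinate M d F \<xi> p y v; \<kappa> ^ n * d x y \<le> \<tau>\<^sub>u\<rbrakk> \<Longrightarrow>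
     \<bar>\<kappa> ^ n * d u v - d (F (int n) x) (F (int n) y)\<bar> < \<alpha>"
    using unstable[OF \<open>\<alpha> > 0\<close>] by blast
  obtain N2 where N2: "\<And>n p x s y t. \<lbrakk>n \<ge> N2; unstable_coordinate M d (\<lambda>i. F (- i)) \<xi> p x s;
     unstable_coordinate M d (\<lambda>i. F (- i)) \<xi> p y t; \<kappa> ^ n * d x y \<le> \<tau>\<^sub>s\<rbrakk> \<Longrightarrow>
     \<bar>\<kappa> ^ n * d s t - d (F (- int n) x) (F (- int n) y)\<bar> < \<alpha>"
    using stable[OF \<open>\<alpha> > 0\<close>] by blast
  define N where "N = max N1 N2"
  define \<delta> where "\<delta> = \<tau> / \<kappa> ^ N"
  have "\<delta> > 0" using \<tau> kappa_gt_1 by (simp add: \<delta>_def)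
  moreover have "\<bar>max (d s t) (d u v) / d x y - 1\<bar> < \<epsilon>"
    if cx: "product_coordinates p x s u" and cy: "product_coordinates p y t v"
      and pos: "0 < d x y" and lt: "d x y < \<delta>" for p x s u y t v
  proof -
    have M: "x \<in> M" "y \<in> M" using product_coordinates_carrier cx cy by blast+
    have ltN: "\<kappa> ^ N * d x y < \<tau>"
      using lt kappa_gt_1 by (simp add: \<delta>_def pos_less_divide_eq mult.commute)
    obtain m where m: "\<tau> / d x y < \<kappa> ^ m" using real_arch_pow[OF kappa_gt_1] by blast
    \<comment> \<open>\<open>n\<close> is the last time before the threshold is crossed, so \<open>P\<close> looks one step ahead.\<close>
    define P where "P k \<longleftrightarrow> \<tau> < \<kappa> ^ Suc k * d x y" for k
    have "\<tau> < \<kappa> ^ m * d x y" using m pos by (simp add: divide_less_eq)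
    also have "\<dots> \<le> \<kappa> ^ Suc m * d x y" using pos kappa_gt_1
      by (intro mult_right_mono power_increasing) auto
    finally have "P m" by (simp add: P_def)
    define n where "n = (LEAST k. P k)"
    have n: "P n" unfolding n_def using \<open>P m\<close> by (rule LeastI)
    have "N \<le> n"
    proof (rule ccontr)
      assume "\<not> N \<le> n"
      then have "\<kappa> ^ Suc n * d x y \<le> \<kappa> ^ N * d x y"
        using pos kappa_gt_1 by (intro mult_right_mono power_increasing) auto
      then show False using n ltN by (simp add: P_def)
    qed
    have le: "\<kappa> ^ n * d x y \<le> \<tau>"
    proof (cases n)
      case 0
      have "1 * d x y \<le> \<kappa> ^ N * d x y" using pos kappa_gt_1 by (intro mult_right_mono) auto
      then show ?thesis using 0 ltN by simp
    next
      case (Suc k)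
      then have "\<not> P k" using not_less_Least[of k P] unfolding n_def by simp
      then show ?thesis using Suc by (simp add: P_def)
    qed
    define K where "K = \<kappa> ^ n"
    have "K > 0" using kappa_gt_1 by (simp add: K_def)
    have "\<bar>K * d u v - d (F (int n) x) (F (int n) y)\<bar> < \<alpha>"
      using N1[of n p x u y v] cx cy le \<tau> \<open>N \<le> n\<close> by (simp add: N_def K_def product_coordinates_def)
    moreover have "\<bar>K * d s t - d (F (- int n) x) (F (- int n) y)\<bar> < \<alpha>"
      using N2[of n p x s y t] cx cy le \<tau> \<open>N \<le> n\<close> by (simp add: N_def K_def product_coordinates_def)
    moreover have "max (d (F (int n) x) (F (int n) y)) (d (F (- int n) x) (F (- int n) y)) = K * d x y"
      using self_similar_sequence_iterate[OF orbit_distance_self_similar[OF M] kappa_gt_1, of n]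
        le \<tau> M F_zero by (simp add: K_def)
    moreover have "max (K * d s t) (K * d u v) = K * max (d s t) (d u v)"
      using \<open>K > 0\<close> by (simp add: max_mult_distrib_left)
    ultimately have diff: "\<bar>K * max (d s t) (d u v) - K * d x y\<bar> < \<alpha>" by linarith
    have "\<alpha> < \<epsilon> * (K * d x y)"
    proof -
      have "\<tau> < \<kappa> * (K * d x y)" using n by (simp add: P_def K_def mult.assoc)
      then have "\<tau> / \<kappa> < K * d x y" using kappa_gt_1 by (simp add: divide_less_eq mult.commute)
      then show ?thesis unfolding \<alpha>_def using assms by (rule mult_strict_left_mono)
    qed
    with diff have "\<bar>K * max (d s t) (d u v) - K * d x y\<bar> < \<epsilon> * (K * d x y)" by linarith
    moreover have "max (d s t) (d u v) / d x y - 1 =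
        (K * max (d s t) (d u v) - K * d x y) / (K * d x y)"
      using \<open>K > 0\<close> pos by (simp add: field_simps)
    ultimately show ?thesis
      using \<open>K > 0\<close> pos by (simp add: abs_divide pos_divide_less_eq)
  qed
  ultimately show ?thesis by blast
qed

text \<open>
  The distance of \<open>x\<close> and \<open>y\<close> exceeds that of their unstable coordinates by at most \<open>2\<xi>\<close> at all
  future times, and that of their stable coordinates by at most \<open>2\<xi>\<close> at all past times. If the
  coordinates are \<open>\<xi>\<close>-close on a long window around time \<open>0\<close>, then \<open>x\<close> and \<open>y\<close> are \<open>3\<xi>\<close>-close on it.
\<close>

lemma product_coordinates_determine:
  assumes "\<alpha> > 0"
  shows "\<exists>\<delta>>0. \<forall>p x s u y t v. product_coordinates p x s u \<longrightarrow> product_coordinates p y t v \<longrightarrow>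
     max (d s t) (d u v) < \<delta> \<longrightarrow> d x y < \<alpha>"
proof -
  obtain N where N: "\<And>u v. \<lbrakk>u \<in> M; v \<in> M; \<And>i. \<bar>i\<bar> \<le> int N \<Longrightarrow> d (F i u) (F i v) \<le> 3 * \<xi>\<rbrakk>
      \<Longrightarrow> d u v < \<alpha>"
    using uniform_expansivity[OF assms] by blast
  define \<delta> where "\<delta> = min \<xi> \<eta> / \<kappa> ^ N"
  have "\<delta> > 0" using xi_pos eta_pos kappa_gt_1 by (simp add: \<delta>_def)
  moreover have "d x y < \<alpha>" if cx: "product_coordinates p x s u" and cy: "product_coordinates p y t v"
    and lt: "max (d s t) (d u v) < \<delta>" for p x s u y t v
  proof (rule N)
    have M: "x \<in> M" "s \<in> M" "u \<in> M" "y \<in> M" "t \<in> M" "v \<in> M"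
      using product_coordinates_carrier cx cy by blast+
    then show "x \<in> M" "y \<in> M" by auto
    have cu: "unstable_coordinate M d F \<xi> p x u" "unstable_coordinate M d F \<xi> p y v"
      and cs: "unstable_coordinate M d (\<lambda>i. F (- i)) \<xi> p x s"
        "unstable_coordinate M d (\<lambda>i. F (- i)) \<xi> p y t"
      using cx cy by (auto simp: product_coordinates_def)
    have close: "d (F i w) (F i z) \<le> \<xi>" if "d w z < \<delta>" "w \<in> M" "z \<in> M" "\<bar>i\<bar> \<le> int N" for w z i
    proof -
      have "\<kappa> ^ N * d w z < min \<xi> \<eta>"
        using that(1) kappa_gt_1 by (simp add: \<delta>_def pos_less_divide_eq mult.commute)
      then show ?thesis using orbit_distance_upper_bound[of w z N i] that by simp
    qed
    fix i assume i: "\<bar>i\<bar> \<le> int N"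
    show "d (F i x) (F i y) \<le> 3 * \<xi>"
    proof (cases "i \<ge> 0")
      case True
      have "d (F i u) (F i v) \<le> \<xi>" using close lt M i by simp
      then show ?thesis using unstable_coordinates_future[OF cu True] by linarith
    next
      case False
      have "d (F i s) (F i t) \<le> \<xi>" using close lt M i by simp
      then show ?thesis using self_similar_action.unstable_coordinates_future[OF reflected cs, of "- i"] False by simp
    qed
  qed
  ultimately show ?thesis by blast
qed

section \<open>The maximum metric in product coordinates\<close>

text \<open>
  Besides the ratio itself, the ratio estimate gives continuity towards the maximum metric, whereas
  uniform determination gives both the continuity of the inverse and the separation of points.
\<close>

lemma pseudo_isometry_max_coordinates:
  assumes coords: "\<And>x. x \<in> C \<Longrightarrow> product_coordinates p x (\<sigma> x) (\<upsilon> x)"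
  shows "pseudo_isometry C d C (\<lambda>x y. max (d (\<sigma> x) (\<sigma> y)) (d (\<upsilon> x) (\<upsilon> y))) (\<lambda>x. x)"
proof -
  define e where "e x y = max (d (\<sigma> x) (\<sigma> y)) (d (\<upsilon> x) (\<upsilon> y))" for x y
  have M: "x \<in> M" "\<sigma> x \<in> M" "\<upsilon> x \<in> M" if "x \<in> C" for x
    using product_coordinates_carrier coords[OF that] by blast+
  have ratio: "\<exists>\<delta>>0. \<forall>x\<in>C. \<forall>y\<in>C. 0 < d x y \<and> d x y < \<delta> \<longrightarrow> \<bar>e x y / d x y - 1\<bar> < \<epsilon>"
    if "\<epsilon> > 0" for \<epsilon>
    using product_coordinates_ratio[OF that] coords unfolding e_def by meson
  have determine: "\<exists>\<delta>>0. \<forall>x\<in>C. \<forall>y\<in>C. e x y < \<delta> \<longrightarrow> d x y < \<alpha>" if "\<alpha> > 0" for \<alpha>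
    using product_coordinates_determine[OF that] coords unfolding e_def by meson
  have e_self: "e x x = 0" if "x \<in> C" for x using M[OF that] by (simp add: e_def)
  have C: "Metric_space C d" using subspace[of C] M(1) by blast
  have Ce: "Metric_space C e"
  proof
    fix x y assume xy: "x \<in> C" "y \<in> C"
    show "e x y = 0 \<longleftrightarrow> x = y"
    proof
      assume "e x y = 0"
      then have "d x y < \<alpha>" if "\<alpha> > 0" for \<alpha> using determine[OF that] xy by auto
      then have "\<not> 0 < d x y" by blast
      then show "x = y" using M(1)[OF xy(1)] M(1)[OF xy(2)] mdist_pos_eq by blast
    qed (use e_self xy in simp)
  next
    fix x y z assume xyz: "x \<in> C" "y \<in> C" "z \<in> C"
    have "d (\<sigma> x) (\<sigma> z) \<le> d (\<sigma> x) (\<sigma> y) + d (\<sigma> y) (\<sigma> z)"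
      "d (\<upsilon> x) (\<upsilon> z) \<le> d (\<upsilon> x) (\<upsilon> y) + d (\<upsilon> y) (\<upsilon> z)"
      using xyz M by (intro triangle; blast)+
    then show "e x z \<le> e x y + e y z" unfolding e_def by linarith
  qed (auto simp: e_def commute max_def)
  have forward: "continuous_map (Metric_space.mtopology C d) (Metric_space.mtopology C e) (\<lambda>x. x)"
    unfolding Metric_space.metric_continuous_map[OF C Ce]
  proof (intro conjI ballI allI impI)
    fix a and \<epsilon> :: real assume a: "a \<in> C" and "\<epsilon> > 0"
    obtain \<delta> where \<delta>: "\<delta> > 0" "\<And>x y. \<lbrakk>x \<in> C; y \<in> C; 0 < d x y; d x y < \<delta>\<rbrakk> \<Longrightarrow> \<bar>e x y / d x y - 1\<bar> < 1"
      using ratio[of 1] by auto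
    have "e a x < \<epsilon>" if "x \<in> C" "d a x < min \<delta> (\<epsilon> / 2)" for x
    proof (cases "a = x")
      case True
      then show ?thesis using e_self a \<open>\<epsilon> > 0\<close> by simp
    next
      case False
      then have pos: "0 < d a x" using a that M(1) by simp
      then have "\<bar>e a x / d a x - 1\<bar> < 1" using \<delta>(2)[OF a] that by simp
      then have "e a x / d a x < 2" by linarith
      then have "e a x < 2 * d a x" using pos by (simp add: divide_less_eq)
      then show ?thesis using that by simp
    qed
    moreover have "min \<delta> (\<epsilon> / 2) > 0" using \<delta> \<open>\<epsilon> > 0\<close> by simp
    ultimately show "\<exists>\<delta>>0. \<forall>x. x \<in> C \<and> d a x < \<delta> \<longrightarrow> e a x < \<epsilon>" by blast
  qed auto
  have backward: "continuous_map (Metric_space.mtopology C e) (Metric_space.mtopology C d) (\<lambda>x. x)"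
    unfolding Metric_space.metric_continuous_map[OF Ce C] using determine by (simp add: Ball_def) meson
  have "homeomorphic_maps (Metric_space.mtopology C d) (Metric_space.mtopology C e) (\<lambda>x. x) (\<lambda>x. x)"
    using forward backward by (simp add: homeomorphic_maps_def)
  then have "homeomorphic_map (Metric_space.mtopology C d) (Metric_space.mtopology C e) (\<lambda>x. x)"
    by (rule homeomorphic_maps_imp_map)
  then have "pseudo_isometry C d C e (\<lambda>x. x)"
    using C Ce ratio by (simp add: pseudo_isometry_def)
  then show ?thesis unfolding e_def .
qed

end

section \<open>The action generated by a homeomorphism\<close>

definition int_iterate :: "('a \<Rightarrow> 'a) \<Rightarrow> ('a \<Rightarrow> 'a) \<Rightarrow> int \<Rightarrow> 'a \<Rightarrow> 'a" where
  "int_iterate f g i x = (if i \<ge> 0 then (f ^^ nat i) x else (g ^^ nat (- i)) x)"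

lemma int_iterate_add:
  assumes f: "\<And>x. x \<in> M \<Longrightarrow> f x \<in> M" and g: "\<And>x. x \<in> M \<Longrightarrow> g x \<in> M"
    and gf: "\<And>x. x \<in> M \<Longrightarrow> g (f x) = x" and fg: "\<And>x. x \<in> M \<Longrightarrow> f (g x) = x"
    and "x \<in> M"
  shows "int_iterate f g i x \<in> M"
    and "int_iterate f g (i + j) x = int_iterate f g i (int_iterate f g j x)"
proof -
  have fM: "(f ^^ n) y \<in> M" and gM: "(g ^^ n) y \<in> M" if "y \<in> M" for n y
    using that f g by (induction n) auto
  have closed: "int_iterate f g i y \<in> M" if "y \<in> M" for i y
    using fM gM that by (simp add: int_iterate_def)
  then show "int_iterate f g i x \<in> M" using \<open>x \<in> M\<close> .
  have up: "int_iterate f g (k + 1) y = f (int_iterate f g k y)" if "y \<in> M" for k y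
  proof (cases "k \<ge> 0")
    case True
    then have "nat (k + 1) = Suc (nat k)" by simp
    then show ?thesis using True by (simp add: int_iterate_def)
  next
    case False
    then have "nat (- k) = Suc (nat (- (k + 1)))" by simp
    then show ?thesis using False fg gM[OF that] by (auto simp: int_iterate_def)
  qed
  have down: "int_iterate f g (k - 1) y = g (int_iterate f g k y)" if "y \<in> M" for k y
    using up[OF that, of "k - 1"] gf closed[OF that] by simp
  show "int_iterate f g (i + j) x = int_iterate f g i (int_iterate f g j x)"
  proof (induction i rule: int_induct[where k = 0])
    case base
    then show ?case by (simp add: int_iterate_def)
  next
    case (step1 i)
    then show ?case using up[OF \<open>x \<in> M\<close>, of "i + j"] up[OF closed[OF \<open>x \<in> M\<close>], of i j]
      by (simp add: ac_simps)
  next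
    case (step2 i)
    have "i - 1 + j = i + j - 1" by simp
    then show ?case using step2 down[OF \<open>x \<in> M\<close>, of "i + j"] down[OF closed[OF \<open>x \<in> M\<close>], of i j]
      by metis
  qed
qed

lemma int_iterate_of_nat:
  "int_iterate f g (int n) x = (f ^^ n) x" "int_iterate f g (- int n) x = (g ^^ n) x"
  by (auto simp: int_iterate_def)

lemma stable_set_int_iterate:
  "y \<in> stable_set M d f \<epsilon> x \<longleftrightarrow>
     y \<in> M \<and> (\<forall>i\<ge>0. d (int_iterate f g i x) (int_iterate f g i y) \<le> \<epsilon>)"
  unfolding stable_set_def by (simp add: all_nat int_iterate_def)

lemma unstable_set_int_iterate:
  "y \<in> unstable_set M d f \<epsilon> x \<longleftrightarrow>
     y \<in> M \<and> (\<forall>i\<le>0. d (int_iterate f (inv_into M f) i x) (int_iterate f (inv_into M f) i y) \<le> \<epsilon>)"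
  (is "_ \<longleftrightarrow> _ \<and> (\<forall>i\<le>0. ?P i)")
proof -
  have "(\<forall>i\<le>0. ?P i) \<longleftrightarrow> (\<forall>n::nat. ?P (- int n))"
    by (metis neg_0_le_iff_le minus_minus nonneg_int_cases of_nat_0_le_iff neg_le_0_iff_le)
  then show ?thesis unfolding unstable_set_def by (simp add: int_iterate_of_nat)
qed

theorem theorem4p4:
  fixes M C :: "'a set" and d\<^sub>0 d :: "'a \<Rightarrow> 'a \<Rightarrow> real" and f :: "'a \<Rightarrow> 'a"
    and \<xi> :: real and p :: 'a
  assumes "Metric_space M d\<^sub>0"
    and "compact_space (Metric_space.mtopology M d\<^sub>0)"
    and "homeomorphic_map (Metric_space.mtopology M d\<^sub>0) (Metric_space.mtopology M d\<^sub>0) f"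
    and "expansive M d\<^sub>0 f"
    and "canonical_coordinates M d\<^sub>0 f"
    and "self_similar_metric M (Metric_space.mtopology M d\<^sub>0) f d"
    and "\<xi> > 0" and "expansive_constant M d f (3 * \<xi>)"
    and "product_box M d f \<xi> C"
    and "p \<in> C"
  shows "pseudo_isometric C d C (box_metric M d f \<xi> p)"
proof -
  define g where "g = inv_into M f"
  define F where "F = int_iterate f g"
  obtain \<eta> \<kappa> where d: "Metric_space M d" and top: "Metric_space.mtopology M d = Metric_space.mtopology M d\<^sub>0"
    and \<eta>: "expansive_constant M d f \<eta>" and "\<kappa> > 1"
    and sim: "\<And>x y. \<lbrakk>x \<in> M; y \<in> M; d x y \<le> \<eta>\<rbrakk> \<Longrightarrow> max (d (f x) (f y)) (d (g x) (g y)) = \<kappa> * d x y"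
    using assms(6) unfolding self_similar_metric_def g_def by blast
  have bij: "f ` M = M" "inj_on f M"
    using homeomorphic_imp_surjective_map[OF assms(3)] homeomorphic_imp_injective_map[OF assms(3)]
      Metric_space.topspace_mtopology[OF assms(1)] by auto
  have fM: "f x \<in> M" and gM: "g x \<in> M" and gf: "g (f x) = x" and fg: "f (g x) = x" if "x \<in> M" for x
    using that bij inv_into_into[of x f M] inv_into_f_f[of f M x] f_inv_into_f[of x f M]
    by (auto simp: g_def)
  have action: "self_similar_action M d F \<eta> \<kappa> \<xi>"
  proof (rule self_similar_action.intro[OF d], unfold_locales)
    show "compact_space (Metric_space.mtopology M d)" using assms(2) top by simp
    show "F i x \<in> M" if "x \<in> M" for i x
      unfolding F_def by (rule int_iterate_add(1)) (use fM gM gf fg that in auto)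
    show "F (i + j) x = F i (F j x)" if "x \<in> M" for i j x
      unfolding F_def by (rule int_iterate_add(2)) (use fM gM gf fg that in auto)
    show "F 0 x = x" for x by (simp add: F_def int_iterate_def)
    show "\<eta> > 0" using \<eta> by (simp add: expansive_constant_def)
    show "max (d (F 1 x) (F 1 y)) (d (F (-1) x) (F (-1) y)) = \<kappa> * d x y"
      if "x \<in> M" "y \<in> M" "d x y \<le> \<eta>" for x y
      using sim[OF that] by (simp add: F_def int_iterate_def)
    show "x = y" if "x \<in> M" "y \<in> M" "\<And>i. d (F i x) (F i y) \<le> 3 * \<xi>" for x y
      using that(1,2) that(3)[of "int _"] that(3)[of "- int _"] assms(8)
      unfolding expansive_constant_def F_def int_iterate_of_nat g_def by blast
  qed (use \<open>\<kappa> > 1\<close> assms(7) in auto)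
  obtain q r where C: "C = box_set M d f \<xi> r q"
    and box: "\<And>x y. \<lbrakk>x \<in> stable_set M d f r q; y \<in> unstable_set M d f r q\<rbrakk> \<Longrightarrow> bracket_defined M d f \<xi> y x"
    and brackets: "\<And>x y. \<lbrakk>x \<in> C; y \<in> C\<rbrakk> \<Longrightarrow> bracket_defined M d f \<xi> x y"
    using assms(9) unfolding product_box_def by blast
  have the_elem_mem: "the_elem A \<in> A" if "is_singleton A" for A :: "'a set"
    using that by (auto elim: is_singletonE)
  have CM: "x \<in> M" if "x \<in> C" for x
    using that box the_elem_mem unfolding C box_set_def bracket_def bracket_defined_def
    by (fastforce simp: stable_set_def)
  have stable: "y \<in> stable_set M d f \<xi> z \<longleftrightarrow> y \<in> M \<and> (\<forall>i\<ge>0. d (F i z) (F i y) \<le> \<xi>)" for y z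
    unfolding F_def by (rule stable_set_int_iterate)
  have unstable: "y \<in> unstable_set M d f \<xi> z \<longleftrightarrow> y \<in> M \<and> (\<forall>i\<le>0. d (F i z) (F i y) \<le> \<xi>)" for y z
    unfolding F_def g_def by (rule unstable_set_int_iterate)
  have "self_similar_action.product_coordinates M d F \<xi> p x
      (s_coord M d f \<xi> p x) (u_coord M d f \<xi> p x)" if x: "x \<in> C" for x
  proof -
    have s: "s_coord M d f \<xi> p x \<in> stable_set M d f \<xi> p \<inter> unstable_set M d f \<xi> x"
      using brackets[OF \<open>p \<in> C\<close> x] unfolding s_coord_def bracket_defined_def
      by (rule the_elem_mem)
    have u: "u_coord M d f \<xi> p x \<in> unstable_set M d f \<xi> p \<inter> stable_set M d f \<xi> x"
      using brackets[OF x \<open>p \<in> C\<close>] unfolding u_coord_def bracket_defined_def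
      by (subst (1 2) Int_commute) (rule the_elem_mem)
    show ?thesis
      using s u CM[OF x] CM[OF \<open>p \<in> C\<close>]
      unfolding self_similar_action.product_coordinates_def[OF action] unstable_coordinate_def
      by (auto simp: stable unstable)
  qed
  from self_similar_action.pseudo_isometry_max_coordinates[OF action this] show ?thesis
    unfolding pseudo_isometric_def box_metric_def[abs_def] by blast
qed

end
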